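(* Let $x_0\in M$ be fixed. The function $\bar A\mapsto J(\bar A,x_0)$ is strictly convex on $\mathbb{R}^{n\times n}$ if and only if $\Gamma_2\succ 0$ (positive definite). Moreover, when $\Gamma_2\succ0$, the matrix $\hat A(x_0)\triangleq \Gamma_1\Gamma_2^{-1}$ is the global minimizer of $\bar A\mapsto J(\bar A,x_0)$ over $\mathbb{R}^{n\times n}$.
   Context: Let $f:\mathbb{R}^n\to\mathbb{R}^n$ be smooth with $f(0)=0$, and consider $\dot x(t)=f(x(t))$, $x(0)=x_0$, with solution denoted $s(t,x_0)$. The origin is a locally exponentially stable equilibrium point with region of attraction $M\subseteq\mathbb{R}^n$, i.e. the set of $x_0$ for which $s(t,x_0)$ exists for all $t\ge 0$ and $s(t,x_0)\to0$ as $t\to\infty$. The Jacobian $A\triangleq f_x(0)$ is Hurwitz, and $g(x)\triangleq f(x)-Ax$ satisfies $g(x)=o(x)$, i.e. $\|g(x)\|/\|x\|\to0$ as $\|x\|\to0$. Here $\|\cdot\|$ is the Euclidean norm on $\mathbb{R}^n$. For $\bar A\in\mathbb{R}^{n\times n}$ and $x_0\in M$ define $$J(\bar A,x_0)=\int_0^\infty\|f(s(t,x_0))-\bar A s(t,x_0)\|^2\,\mathrm{d}t,$$ $$\Gamma_1=\int_0^\infty f(s(t,x_0))\,s(t,x_0)^\top\,\mathrm{d}t,\qquad \Gamma_2=\int_0^\infty s(t,x_0)\,s(t,x_0)^\top\,\mathrm{d}t.$$ *)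

theory Defs
  imports "HOL-Analysis.Analysis"
begin

fun Ck :: "nat \<Rightarrow> ('a::real_normed_vector \<Rightarrow> 'b::real_normed_vector) \<Rightarrow> bool" where
  "Ck 0 f \<longleftrightarrow> continuous_on UNIV f"
| "Ck (Suc k) f \<longleftrightarrow>
     (\<forall>x. f differentiable (at x)) \<and> (\<forall>v. Ck k (\<lambda>x. frechet_derivative f (at x) v))"

definition smooth :: "('a::real_normed_vector \<Rightarrow> 'b::real_normed_vector) \<Rightarrow> bool" where
  "smooth f \<longleftrightarrow> (\<forall>k. Ck k f)"

definition ode_solution ::
  "('a::real_normed_vector \<Rightarrow> 'a) \<Rightarrow> 'a \<Rightarrow> (real \<Rightarrow> 'a) \<Rightarrow> bool" where
  "ode_solution f x0 x \<longleftrightarrow>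
     x 0 = x0 \<and> (\<forall>t\<ge>0. (x has_vector_derivative f (x t)) (at t within {0..}))"

text \<open>For smooth \<open>f\<close> a solution on \<open>[0, \<infinity>)\<close> is unique there if it exists, so the choice below
  does not matter for \<open>t \<ge> 0\<close>. If there is no such solution, the value carries no information;
  existence is therefore required explicitly wherever the flow is used.\<close>

definition flow :: "('a::real_normed_vector \<Rightarrow> 'a) \<Rightarrow> real \<Rightarrow> 'a \<Rightarrow> 'a" where
  "flow f t x0 = (SOME x. ode_solution f x0 x) t"

definition region_of_attraction :: "('a::real_normed_vector \<Rightarrow> 'a) \<Rightarrow> 'a set" where
  "region_of_attraction f =
     {x0. (\<exists>x. ode_solution f x0 x) \<and> ((\<lambda>t. flow f t x0) \<longlongrightarrow> 0) at_top}"

definition locally_exponentially_stable :: "('a::real_normed_vector \<Rightarrow> 'a) \<Rightarrow> bool" where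
  "locally_exponentially_stable f \<longleftrightarrow>
     (\<exists>r>0. \<exists>c>0. \<exists>a>0. \<forall>x0. norm x0 < r \<longrightarrow>
        (\<exists>x. ode_solution f x0 x) \<and>
        (\<forall>t\<ge>0. norm (flow f t x0) \<le> c * norm x0 * exp (- a * t)))"

text \<open>Eigenvalues of a real matrix are taken over the complex numbers.\<close>

definition hurwitz :: "real^'n^'n \<Rightarrow> bool" where
  "hurwitz A \<longleftrightarrow>
     (\<forall>z::complex. (\<exists>v::complex^'n. v \<noteq> 0 \<and> map_matrix complex_of_real A *v v = z *s v)
        \<longrightarrow> Re z < 0)"

definition pos_def :: "real^'n^'n \<Rightarrow> bool" where
  "pos_def A \<longleftrightarrow> transpose A = A \<and> (\<forall>x. x \<noteq> 0 \<longrightarrow> x \<bullet> (A *v x) > 0)"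

definition strictly_convex_on :: "'a::real_vector set \<Rightarrow> ('a \<Rightarrow> real) \<Rightarrow> bool" where
  "strictly_convex_on S f \<longleftrightarrow> convex S \<and>
     (\<forall>x\<in>S. \<forall>y\<in>S. \<forall>u. x \<noteq> y \<longrightarrow> 0 < u \<longrightarrow> u < 1 \<longrightarrow>
        f (u *\<^sub>R x + (1 - u) *\<^sub>R y) < u * f x + (1 - u) * f y)"

text \<open>The matrix \<open>v w\<^sup>T\<close>.\<close>

definition outer :: "real^'n \<Rightarrow> real^'m \<Rightarrow> real^'m^'n" where
  "outer v w = (\<chi> i j. v $ i * w $ j)"

definition J :: "(real^'n \<Rightarrow> real^'n) \<Rightarrow> real^'n^'n \<Rightarrow> real^'n \<Rightarrow> real" where
  "J f B x0 = integral {0..} (\<lambda>t. (norm (f (flow f t x0) - B *v flow f t x0))\<^sup>2)"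

definition Gamma1 :: "(real^'n \<Rightarrow> real^'n) \<Rightarrow> real^'n \<Rightarrow> real^'n^'n" where
  "Gamma1 f x0 = integral {0..} (\<lambda>t. outer (f (flow f t x0)) (flow f t x0))"

definition Gamma2 :: "(real^'n \<Rightarrow> real^'n) \<Rightarrow> real^'n \<Rightarrow> real^'n^'n" where
  "Gamma2 f x0 = integral {0..} (\<lambda>t. outer (flow f t x0) (flow f t x0))"

end

(* The trajectory enters the ball of local exponential stability in finite time, so (solutions being
   unique) it decays exponentially, and so does f along it because f is Lipschitz on balls and f 0 = 0.
   Hence all products of components are integrable, and in terms of the entrywise inner product of
   matrices J B = c - 2 <B, Gamma1> + <B, B Gamma2>. Strict convexity therefore means <H, H Gamma2> > 0
   for all H \<noteq> 0; since <H, H Gamma2> is the sum of the quadratic form of Gamma2 over the rows of H,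
   this is positive definiteness. Completing the square at Gamma1 Gamma2^-1 gives the minimizer. *)
theory Submission
  imports Defs
begin

section \<open>Lipschitz bounds and uniqueness of solutions\<close>

text \<open>Mean value inequality on a convex compact ball, where the operator norm of the
  derivative is bounded.\<close>

lemma Ck_Suc_lipschitz_on_cball:
  fixes f :: "'a::euclidean_space \<Rightarrow> 'b::real_normed_vector"
  assumes "Ck (Suc k) f"
  shows "\<exists>L\<ge>0. \<forall>x\<in>cball 0 R. \<forall>y\<in>cball 0 R. norm (f x - f y) \<le> L * norm (x - y)"
proof -
  have diff: "f differentiable (at x)" for x
    using assms by simp
  have der: "(f has_derivative frechet_derivative f (at x)) (at x)" for x
    using diff frechet_derivative_works by blast
  have cont: "continuous_on UNIV (\<lambda>x. frechet_derivative f (at x) v)" for v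
  proof (cases k)
    case 0
    then show ?thesis using assms by simp
  next
    case (Suc j)
    then have "(\<lambda>x. frechet_derivative f (at x) v) differentiable (at x)" for x
      using assms by simp
    then show ?thesis
      by (simp add: continuous_at_imp_continuous_on differentiable_imp_continuous_within)
  qed
  \<comment> \<open>\<open>Ck\<close> gives continuity of the derivative only in each fixed
    direction. This sum over the basis is therefore continuous, and it dominates the operator
    norm.\<close>
  let ?h = "\<lambda>x. \<Sum>i\<in>Basis. norm (frechet_derivative f (at x) i)"
  have "continuous_on (cball 0 R) ?h"
    by (intro continuous_intros continuous_on_subset[OF cont]) auto
  then have "compact (?h ` cball 0 R)"
    by (intro compact_continuous_image compact_cball)
  then obtain L where L: "\<And>x. x \<in> cball 0 R \<Longrightarrow> ?h x \<le> L"
    by (meson bounded_imp_bdd_above bdd_above.E compact_imp_bounded image_eqI)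
  \<comment> \<open>For \<open>R < 0\<close> the ball is empty and \<open>L\<close> may be negative,
    hence \<open>max L 0\<close>.\<close>
  have "norm (f x - f y) \<le> max L 0 * norm (x - y)" if "x \<in> cball 0 R" "y \<in> cball 0 R" for x y
  proof (rule differentiable_bound[where S = "cball 0 R" and f' = "\<lambda>x. frechet_derivative f (at x)"])
    fix z :: 'a assume z: "z \<in> cball 0 R"
    show "(f has_derivative frechet_derivative f (at z)) (at z within cball 0 R)"
      using der by (rule has_derivative_at_withinI)
    show "onorm (frechet_derivative f (at z)) \<le> max L 0"
      using onorm_componentwise[OF has_derivative_bounded_linear[OF der[of z]]] L[OF z] by linarith
  qed (use that in auto)
  then show ?thesis by (intro exI[of _ "max L 0"]) auto
qed

lemma ode_solution_continuous_on:
  assumes "ode_solution f x0 x"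
  shows "continuous_on {0..} x"
  using assms unfolding ode_solution_def continuous_on_eq_continuous_within
  by (auto intro: has_vector_derivative_continuous)

lemma ode_solution_bounded_on_interval:
  assumes "ode_solution f x0 x"
  shows "\<exists>R. \<forall>t\<in>{0..T}. norm (x t) \<le> R"
proof -
  have "compact (x ` {0..T})"
    by (intro compact_continuous_image continuous_on_subset[OF ode_solution_continuous_on[OF assms]]) auto
  then show ?thesis
    by (auto dest!: compact_imp_bounded simp: bounded_iff)
qed

text \<open>Gronwall's argument: on \<open>{0..T}\<close> both solutions stay in one ball, on which
  \<open>f\<close> is Lipschitz.\<close>

lemma ode_solution_unique:
  fixes f :: "'a::euclidean_space \<Rightarrow> 'a"
  assumes f: "Ck (Suc k) f" and x: "ode_solution f x0 x" and y: "ode_solution f x0 y" and "T \<ge> 0"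
  shows "x T = y T"
proof -
  obtain R1 where R1: "\<forall>t\<in>{0..T}. norm (x t) \<le> R1"
    using ode_solution_bounded_on_interval[OF x] by blast
  obtain R2 where R2: "\<forall>t\<in>{0..T}. norm (y t) \<le> R2"
    using ode_solution_bounded_on_interval[OF y] by blast
  obtain L where L: "\<forall>u\<in>cball 0 (max R1 R2). \<forall>v\<in>cball 0 (max R1 R2). norm (f u - f v) \<le> L * norm (u - v)"
    using Ck_Suc_lipschitz_on_cball[OF f] by blast
  have lip: "norm (f (x t) - f (y t)) \<le> L * norm (x t - y t)" if "t \<in> {0..T}" for t
    using L R1 R2 that by (simp add: max.coboundedI1 max.coboundedI2)
  \<comment> \<open>The squared distance grows at rate at most \<open>2 * L\<close>, so this weight
    makes it nonincreasing.\<close>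
  define w where "w t = ((x t - y t) \<bullet> (x t - y t)) * exp (- (2 * L) * t)" for t
  have "w T \<le> w 0"
  proof (rule DERIV_nonpos_imp_decreasing_open[OF \<open>T \<ge> 0\<close>])
    show "continuous_on {0..T} w"
      unfolding w_def
      by (intro continuous_intros continuous_on_subset[OF ode_solution_continuous_on[OF x]]
          continuous_on_subset[OF ode_solution_continuous_on[OF y]]) auto
    fix t assume t: "0 < t" "t < T"
    \<comment> \<open>The equation is stated with derivatives within the half-line; at an interior
      point these are two-sided.\<close>
    then have nhds: "at t within {0..} = at t"
      by (intro at_within_interior) auto
    have dx: "(x has_vector_derivative f (x t)) (at t)" and dy: "(y has_vector_derivative f (y t)) (at t)"
      using x y t unfolding ode_solution_def nhds[symmetric] by auto
    let ?d = "x t - y t" and ?e = "f (x t) - f (y t)"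
    have "((\<lambda>t. x t - y t) has_derivative (\<lambda>h. h *\<^sub>R ?e)) (at t)"
      using has_vector_derivative_diff[OF dx dy] by (simp add: has_vector_derivative_def)
    from has_derivative_inner[OF this this]
    have "((\<lambda>t. (x t - y t) \<bullet> (x t - y t)) has_real_derivative 2 * (?d \<bullet> ?e)) (at t)"
      by (rule has_derivative_imp_has_field_derivative) (simp add: inner_commute)
    then have "(w has_real_derivative
        2 * (?d \<bullet> ?e) * exp (- (2 * L) * t) + exp (- (2 * L) * t) * (- (2 * L)) * (?d \<bullet> ?d)) (at t)"
      unfolding w_def by (auto intro!: derivative_eq_intros)
    moreover have "?d \<bullet> ?e \<le> L * (?d \<bullet> ?d)"
    proof -
      have "?d \<bullet> ?e \<le> norm ?d * norm ?e"
        by (rule norm_cauchy_schwarz)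
      also have "\<dots> \<le> norm ?d * (L * norm ?d)"
        using lip[of t] t by (intro mult_left_mono) auto
      finally show ?thesis
        by (simp add: dot_square_norm power2_eq_square mult_ac)
    qed
    then have "2 * (?d \<bullet> ?e - L * (?d \<bullet> ?d)) * exp (- (2 * L) * t) \<le> 0"
      by (simp add: mult_nonpos_nonneg)
    then have "2 * (?d \<bullet> ?e) * exp (- (2 * L) * t) + exp (- (2 * L) * t) * (- (2 * L)) * (?d \<bullet> ?d) \<le> 0"
      by (simp add: algebra_simps)
    ultimately show "\<exists>D. (w has_real_derivative D) (at t) \<and> D \<le> 0"
      by blast
  qed
  \<comment> \<open>The common initial value gives \<open>w 0 = 0\<close>, and the exponential
    factor is positive.\<close>
  then have "(x T - y T) \<bullet> (x T - y T) \<le> 0"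
    using x y by (simp add: w_def ode_solution_def mult_le_0_iff)
  then have "(x T - y T) \<bullet> (x T - y T) = 0"
    by (intro antisym inner_ge_zero)
  then show ?thesis
    by simp
qed

section \<open>Exponential decay of the flow and integrability\<close>

text \<open>The equation is autonomous. This lets the tail of a trajectory be compared with the flow
  started at a later point.\<close>

lemma ode_solution_shift:
  assumes x: "ode_solution f x0 x" and "T \<ge> 0"
  shows "ode_solution f (x T) (\<lambda>t. x (T + t))"
  unfolding ode_solution_def
proof safe
  fix t :: real assume t: "0 \<le> t"
  have *: "(x has_vector_derivative f (x (T + t))) (at (T + t) within (\<lambda>t. T + t) ` {0..})"
    using x t \<open>T \<ge> 0\<close> unfolding ode_solution_def
    by (intro has_vector_derivative_within_subset[where S = "{0..}" and T = "(\<lambda>t. T + t) ` {0..}"]) auto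
  have "((\<lambda>t. T + t) has_vector_derivative 1) (at t within {0..})"
    by (auto intro!: derivative_eq_intros)
  from vector_diff_chain_within[OF this *]
  show "((\<lambda>t. x (T + t)) has_vector_derivative f (x (T + t))) (at t within {0..})"
    by (simp add: o_def)
qed simp

lemma ode_solution_flow:
  assumes "\<exists>x. ode_solution f x0 x"
  shows "ode_solution f x0 (\<lambda>t. flow f t x0)"
  using someI_ex[OF assms] unfolding flow_def by simp

text \<open>Convergence to the origin brings the trajectory into the ball of local stability at some
  time \<open>T\<close>. From then on the local estimate applies; before \<open>T\<close> a
  compactness bound suffices.\<close>

lemma flow_exponential_decay:
  fixes f :: "'a::euclidean_space \<Rightarrow> 'a"
  assumes f: "Ck (Suc k) f" and "locally_exponentially_stable f" and x0: "x0 \<in> region_of_attraction f"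
  shows "\<exists>K\<ge>0. \<exists>a>0. \<forall>t\<ge>0. norm (flow f t x0) \<le> K * exp (- a * t)"
proof -
  let ?s = "\<lambda>t. flow f t x0"
  obtain r c a where r: "r > 0" and c: "c > 0" and a: "a > 0"
    and les: "\<And>y. norm y < r \<Longrightarrow> (\<exists>x. ode_solution f y x) \<and>
        (\<forall>t\<ge>0. norm (flow f t y) \<le> c * norm y * exp (- a * t))"
    using assms(2) unfolding locally_exponentially_stable_def by metis
  have s: "ode_solution f x0 ?s" and lim: "(?s \<longlongrightarrow> 0) at_top"
    using x0 ode_solution_flow unfolding region_of_attraction_def by auto
  have "\<forall>\<^sub>F t in at_top. norm (?s t) < r"
    using lim r unfolding tendsto_iff by simp
  then obtain T0 where "\<forall>t\<ge>T0. norm (?s t) < r"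
    unfolding eventually_at_top_linorder by blast
  then obtain T where T: "T \<ge> 0" "norm (?s T) < r"
    by (metis max.cobounded1 max.cobounded2)
  obtain M where M: "\<forall>t\<in>{0..T}. norm (?s t) \<le> M"
    using ode_solution_bounded_on_interval[OF s] by blast
  have M0: "M \<ge> 0"
    using M T(1) by (metis atLeastAtMost_iff norm_ge_zero order_refl order_trans)
  \<comment> \<open>The factor \<open>exp (a * T)\<close> restarts the decay at time
    \<open>T\<close>: up to \<open>T\<close> the bound is at least \<open>M\<close>, and afterwards
    it covers the local estimate, whose starting norm is below \<open>r\<close>.\<close>
  define K where "K = max M (c * r) * exp (a * T)"
  have K: "K * exp (- a * t) = max M (c * r) * exp (- a * (t - T))" for t
    unfolding K_def by (simp add: algebra_simps flip: exp_add)
  have "norm (?s t) \<le> K * exp (- a * t)" if t: "t \<ge> 0" for t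
  proof (cases "t \<le> T")
    case True
    then have "norm (?s t) \<le> max M (c * r)" "1 \<le> exp (- a * (t - T))"
      using M t a by (auto simp: max.coboundedI1 mult_nonneg_nonpos)
    then have "norm (?s t) * 1 \<le> max M (c * r) * exp (- a * (t - T))"
      using M0 by (intro mult_mono) auto
    then show ?thesis using K by simp
  next
    case False
    \<comment> \<open>Semigroup property: the shifted trajectory and the chosen flow solve the same
      initial value problem.\<close>
    have "?s (T + (t - T)) = flow f (t - T) (?s T)"
      using les[OF T(2)] False
      by (intro ode_solution_unique[OF f ode_solution_shift[OF s T(1)] ode_solution_flow]) auto
    then have "norm (?s t) \<le> c * norm (?s T) * exp (- a * (t - T))"
      using les[OF T(2)] False by auto
    also have "\<dots> \<le> max M (c * r) * exp (- a * (t - T))"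
      using T(2) c by (intro mult_right_mono) (auto simp: max.coboundedI2)
    finally show ?thesis using K by simp
  qed
  moreover have "K \<ge> 0"
    using M0 by (simp add: K_def max.coboundedI1)
  ultimately show ?thesis using a by blast
qed

lemma integrable_on_exponential_bound:
  fixes g :: "real \<Rightarrow> 'a::euclidean_space"
  assumes cont: "continuous_on {0..} g" and "a > 0"
    and bd: "\<And>t. t \<ge> 0 \<Longrightarrow> norm (g t) \<le> K * exp (- a * t)"
  shows "g integrable_on {0..}"
proof (rule measurable_bounded_by_integrable_imp_integrable)
  show "g \<in> borel_measurable (lebesgue_on {0..})"
    using cont by (intro continuous_imp_measurable_on_sets_lebesgue) auto
  show "(\<lambda>t. K * exp (- a * t)) integrable_on {0..}"
    using integrable_on_exp_minus_to_infinity[OF \<open>a > 0\<close>] by (intro integrable_on_mult_right) auto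
qed (use bd in auto)

section \<open>Outer products and the Frobenius inner product\<close>

text \<open>On matrices \<open>\<bullet>\<close> is the entrywise inner product. The identity
  isolates the matrix \<open>H\<close> from the vectors, so that it can later be moved out of an
  integral.\<close>

lemma inner_outer: "H \<bullet> outer v w = v \<bullet> (H *v w)"
  by (simp add: inner_vec_def outer_def matrix_vector_mult_def sum_distrib_left mult_ac)

lemma norm_outer: "norm (outer v w) = norm v * norm w"
proof -
  have "outer v w *v w = (w \<bullet> w) *\<^sub>R v"
    by (simp add: vec_eq_iff outer_def matrix_vector_mult_def inner_vec_def sum_distrib_left mult_ac)
  then show ?thesis
    by (simp add: norm_eq_sqrt_inner inner_outer real_sqrt_mult mult.commute)
qed

lemma matrix_mul_outer: "B ** outer v w = outer (B *v v) w"
  by (simp add: vec_eq_iff outer_def matrix_matrix_mult_def matrix_vector_mult_def sum_distrib_right mult.assoc)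

lemma transpose_outer: "transpose (outer v w) = outer w v"
  by (simp add: vec_eq_iff outer_def transpose_def mult.commute)

lemma continuous_on_outer:
  assumes "continuous_on S v" "continuous_on S w"
  shows "continuous_on S (\<lambda>t. outer (v t) (w t))"
  unfolding outer_def by (intro continuous_intros assms)

text \<open>Both sides are the trace of \<open>transpose H ** B ** G\<close>. For symmetric
  \<open>G\<close> this makes the bilinear form symmetric in \<open>H\<close> and
  \<open>B\<close>.\<close>

lemma inner_matrix_mul_transpose:
  fixes H B :: "real^'n^'m" and G :: "real^'n^'n"
  shows "H \<bullet> (B ** G) = B \<bullet> (H ** transpose G)"
proof -
  have "(\<Sum>j\<in>UNIV. H $ i $ j * (\<Sum>k\<in>UNIV. B $ i $ k * G $ k $ j)) =
      (\<Sum>k\<in>UNIV. B $ i $ k * (\<Sum>j\<in>UNIV. H $ i $ j * G $ k $ j))" for i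
    unfolding sum_distrib_left by (subst sum.swap) (simp add: mult_ac)
  then show ?thesis
    by (simp add: inner_vec_def matrix_matrix_mult_def transpose_def)
qed

lemma inner_matrix_mul_rows:
  fixes H :: "real^'n^'m" and G :: "real^'n^'n"
  shows "H \<bullet> (H ** G) = (\<Sum>i\<in>UNIV. H $ i \<bullet> (transpose G *v (H $ i)))"
  by (simp add: inner_vec_def matrix_matrix_mult_def matrix_vector_mult_def transpose_def mult_ac)

lemma matrix_add_rdistrib:
  fixes B C :: "real^'n^'m" and G :: "real^'k^'n"
  shows "(B + C) ** G = B ** G + C ** G"
  by (simp add: vec_eq_iff matrix_matrix_mult_def sum.distrib distrib_right)

lemma matrix_diff_rdistrib:
  fixes B C :: "real^'n^'m" and G :: "real^'k^'n"
  shows "(B - C) ** G = B ** G - C ** G"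
  by (simp add: vec_eq_iff matrix_matrix_mult_def sum_subtractf left_diff_distrib)

lemma bounded_linear_inner_matrix_mul:
  fixes B :: "real^'n^'m" and C :: "real^'k^'m"
  shows "bounded_linear (\<lambda>X::real^'k^'n. C \<bullet> (B ** X))"
  unfolding linear_conv_bounded_linear[symmetric]
  by (rule linearI) (simp_all add: matrix_add_ldistrib inner_add_right matrix_scalar_ac flip: scalar_matrix_assoc)

text \<open>The form on matrices is the sum over the rows of \<open>H\<close> of the quadratic form
  of \<open>G\<close>, and a nonzero matrix has a nonzero row.\<close>

lemma pos_def_iff_inner_matrix_mul_pos:
  fixes G :: "real^'n^'n"
  assumes sym: "transpose G = G"
  shows "pos_def G \<longleftrightarrow> (\<forall>H::real^'n^'n. H \<noteq> 0 \<longrightarrow> H \<bullet> (H ** G) > 0)"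
proof
  assume G: "pos_def G"
  have nonneg: "x \<bullet> (G *v x) \<ge> 0" for x
    using G unfolding pos_def_def by (cases "x = 0") (auto simp: less_imp_le)
  show "\<forall>H::real^'n^'n. H \<noteq> 0 \<longrightarrow> H \<bullet> (H ** G) > 0"
  proof safe
    fix H :: "real^'n^'n" assume "H \<noteq> 0"
    then obtain i where "H $ i \<noteq> 0"
      by (auto simp: vec_eq_iff)
    then show "H \<bullet> (H ** G) > 0"
      unfolding inner_matrix_mul_rows sym using G nonneg
      by (intro sum_pos2[of _ i]) (auto simp: pos_def_def)
  qed
next
  assume *: "\<forall>H::real^'n^'n. H \<noteq> 0 \<longrightarrow> H \<bullet> (H ** G) > 0"
  have "x \<bullet> (G *v x) > 0" if "x \<noteq> 0" for x
  proof -
    \<comment> \<open>With every row equal to \<open>x\<close>, the sum over rows is a positive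
      multiple of the form at \<open>x\<close>.\<close>
    have "(\<chi> i::'n. x) \<noteq> 0"
      using that by (simp add: vec_eq_iff)
    then have "0 < (\<chi> i::'n. x) \<bullet> ((\<chi> i::'n. x) ** G)"
      using * by blast
    then show ?thesis
      unfolding inner_matrix_mul_rows sym by (simp add: zero_less_mult_iff)
  qed
  then show "pos_def G"
    unfolding pos_def_def using sym by blast
qed

text \<open>A positive definite matrix has trivial kernel; being square, it is invertible, so the
  choice in \<open>matrix_inv\<close> does return an inverse.\<close>

lemma pos_def_matrix_inv_mul:
  assumes "pos_def G"
  shows "matrix_inv G ** G = mat 1"
proof -
  have "\<forall>x. G *v x = 0 \<longrightarrow> x = 0"
    using assms unfolding pos_def_def by (metis inner_zero_right less_irrefl)
  then have "\<exists>B. B ** G = mat 1"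
    by (simp add: matrix_left_invertible_ker)
  then have "invertible G"
    by (simp add: invertible_left_inverse)
  then show ?thesis
    unfolding matrix_inv_def invertible_def by (rule someI2_ex) blast
qed

section \<open>Convexity and minimization of quadratic functions of a matrix\<close>

definition matrix_quadratic :: "real \<Rightarrow> real^'n^'m \<Rightarrow> real^'n^'n \<Rightarrow> real^'n^'m \<Rightarrow> real" where
  "matrix_quadratic c G1 G2 B = c - 2 * (B \<bullet> G1) + B \<bullet> (B ** G2)"

text \<open>The constant and linear parts are affine, so the gap in Jensen's inequality comes from
  the quadratic part alone.\<close>

lemma matrix_quadratic_convex_combination:
  assumes sym: "transpose G2 = G2"
  shows "matrix_quadratic c G1 G2 (u *\<^sub>R B + (1 - u) *\<^sub>R C) =
    u * matrix_quadratic c G1 G2 B + (1 - u) * matrix_quadratic c G1 G2 C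
      - u * (1 - u) * ((B - C) \<bullet> ((B - C) ** G2))"
proof -
  \<comment> \<open>Symmetry of \<open>G2\<close> merges the two cross terms.\<close>
  have "C \<bullet> (B ** G2) = B \<bullet> (C ** G2)"
    using inner_matrix_mul_transpose[of C B G2] sym by simp
  then show ?thesis
    unfolding matrix_quadratic_def
    by (simp add: inner_add_left inner_add_right inner_diff_left inner_diff_right
        matrix_add_rdistrib matrix_diff_rdistrib algebra_simps power2_eq_square
        flip: scalar_matrix_assoc)
qed

lemma strictly_convex_matrix_quadratic_iff:
  fixes G1 G2 :: "real^'n^'n"
  assumes sym: "transpose G2 = G2"
  shows "strictly_convex_on UNIV (matrix_quadratic c G1 G2) \<longleftrightarrow> pos_def G2"
proof
  assume sc: "strictly_convex_on UNIV (matrix_quadratic c G1 G2)"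
  have "H \<bullet> (H ** G2) > 0" if "H \<noteq> 0" for H :: "real^'n^'n"
  proof -
    let ?q = "matrix_quadratic c G1 G2"
    \<comment> \<open>At the midpoint of \<open>H\<close> and 0 the gap is a quarter of the form at
      \<open>H\<close>.\<close>
    have "?q ((1/2) *\<^sub>R H + (1 - 1/2) *\<^sub>R 0) < 1/2 * ?q H + (1 - 1/2) * ?q 0"
      using sc that unfolding strictly_convex_on_def
      by (elim conjE) (drule bspec[of _ _ H], simp, drule bspec[of _ _ 0], simp, drule spec[of _ "1/2"], simp)
    then show ?thesis
      unfolding matrix_quadratic_convex_combination[OF sym] by simp
  qed
  then show "pos_def G2"
    using pos_def_iff_inner_matrix_mul_pos[OF sym] by blast
next
  assume "pos_def G2"
  then have "(B - C) \<bullet> ((B - C) ** G2) > 0" if "B \<noteq> C" for B C :: "real^'n^'n"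
    using pos_def_iff_inner_matrix_mul_pos[OF sym] that by simp
  then show "strictly_convex_on UNIV (matrix_quadratic c G1 G2)"
    unfolding strictly_convex_on_def matrix_quadratic_convex_combination[OF sym] by simp
qed

text \<open>Completing the square leaves a remainder that is positive away from the center, so the
  minimizer is also unique.\<close>

lemma is_arg_min_matrix_quadratic_iff:
  fixes G1 G2 :: "real^'n^'n"
  assumes G2: "pos_def G2"
  shows "is_arg_min (matrix_quadratic c G1 G2) (\<lambda>_. True) B \<longleftrightarrow> B = G1 ** matrix_inv G2"
proof -
  let ?q = "matrix_quadratic c G1 G2" and ?A = "G1 ** matrix_inv G2"
  have sym: "transpose G2 = G2"
    using G2 by (simp add: pos_def_def)
  have G1: "G1 = ?A ** G2"
    by (simp add: pos_def_matrix_inv_mul[OF G2] flip: matrix_mul_assoc)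
  have q: "?q C = ?q ?A + (C - ?A) \<bullet> ((C - ?A) ** G2)" for C
  proof -
    have "?A \<bullet> (C ** G2) = C \<bullet> G1"
      using inner_matrix_mul_transpose[of ?A C G2] sym G1 by simp
    then show ?thesis
      using G1 unfolding matrix_quadratic_def
      by (simp add: inner_diff_left inner_diff_right matrix_diff_rdistrib)
  qed
  have less: "?q ?A < ?q C" if "C \<noteq> ?A" for C
    using q[of C] pos_def_iff_inner_matrix_mul_pos[OF sym] G2 that by simp
  then show ?thesis
    unfolding is_arg_min_def by (metis less_asym)
qed

section \<open>The cost as a matrix quadratic\<close>

lemma norm_residual_squared:
  fixes v w :: "real^'n" and B :: "real^'n^'n"
  shows "(norm (v - B *v w))\<^sup>2 = (norm v)\<^sup>2 - 2 * (B \<bullet> outer v w) + B \<bullet> (B ** outer w w)"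
  by (simp add: inner_outer matrix_mul_outer power2_norm_eq_inner inner_diff_left inner_diff_right inner_commute)

text \<open>Each term of the expanded integrand is a bounded linear image of an integrable function,
  so the integral passes inside.\<close>

lemma J_eq_matrix_quadratic:
  fixes f :: "real^'n \<Rightarrow> real^'n"
  assumes "(\<lambda>t. (norm (f (flow f t x0)))\<^sup>2) integrable_on {0..}"
    and "(\<lambda>t. outer (f (flow f t x0)) (flow f t x0)) integrable_on {0..}"
    and "(\<lambda>t. outer (flow f t x0) (flow f t x0)) integrable_on {0..}"
  shows "J f B x0 = matrix_quadratic (integral {0..} (\<lambda>t. (norm (f (flow f t x0)))\<^sup>2))
    (Gamma1 f x0) (Gamma2 f x0) B"
proof -
  have 1: "((\<lambda>t. 2 * (B \<bullet> outer (f (flow f t x0)) (flow f t x0))) has_integral 2 * (B \<bullet> Gamma1 f x0)) {0..}"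
    unfolding Gamma1_def using has_integral_linear[OF integrable_integral[OF assms(2)] bounded_linear_inner_right]
    by (intro has_integral_mult_right) (simp add: o_def)
  have 2: "((\<lambda>t. B \<bullet> (B ** outer (flow f t x0) (flow f t x0))) has_integral B \<bullet> (B ** Gamma2 f x0)) {0..}"
    unfolding Gamma2_def using has_integral_linear[OF integrable_integral[OF assms(3)] bounded_linear_inner_matrix_mul]
    by (simp add: o_def)
  show ?thesis
    unfolding J_def norm_residual_squared matrix_quadratic_def
    by (intro integral_unique has_integral_add has_integral_diff 1 2 integrable_integral assms(1))
qed

lemma transpose_Gamma2:
  assumes "(\<lambda>t. outer (flow f t x0) (flow f t x0)) integrable_on {0..}"
  shows "transpose (Gamma2 f x0) = Gamma2 f x0"
proof -
  have "bounded_linear (transpose :: real^'n^'n \<Rightarrow> real^'n^'n)"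
    unfolding linear_conv_bounded_linear[symmetric]
    by (rule linearI) (simp_all add: transpose_def vec_eq_iff)
  from integral_linear[OF assms this] show ?thesis
    by (simp add: Gamma2_def o_def transpose_outer)
qed

text \<open>Both the state and \<open>f\<close> along it are bounded by multiples of
  \<open>exp (- a * t)\<close>, so their products decay at rate \<open>2 * a\<close>.\<close>

lemma flow_products_integrable:
  fixes f :: "real^'n \<Rightarrow> real^'n"
  assumes f: "Ck (Suc k) f" and f0: "f 0 = 0"
    and "locally_exponentially_stable f" and x0: "x0 \<in> region_of_attraction f"
  shows "(\<lambda>t. (norm (f (flow f t x0)))\<^sup>2) integrable_on {0..}"
    and "(\<lambda>t. outer (f (flow f t x0)) (flow f t x0)) integrable_on {0..}"
    and "(\<lambda>t. outer (flow f t x0) (flow f t x0)) integrable_on {0..}"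
proof -
  let ?s = "\<lambda>t. flow f t x0"
  obtain K a where K: "K \<ge> 0" and a: "a > 0" and s: "\<And>t. t \<ge> 0 \<Longrightarrow> norm (?s t) \<le> K * exp (- a * t)"
    using flow_exponential_decay[OF f assms(3) x0] by blast
  \<comment> \<open>The whole trajectory lies in the ball of radius \<open>K\<close>, so a single
    Lipschitz constant serves all times.\<close>
  have sK: "norm (?s t) \<le> K" if "t \<ge> 0" for t
    using s[OF that] K a that
    by (smt (verit) exp_le_one_iff mult_left_le mult_minus_left mult_nonneg_nonneg)
  obtain L where "L \<ge> 0" and L: "\<forall>x\<in>cball 0 K. \<forall>y\<in>cball 0 K. norm (f x - f y) \<le> L * norm (x - y)"
    using Ck_Suc_lipschitz_on_cball[OF f] by blast
  \<comment> \<open>Lipschitz comparison with the equilibrium, which lies in the same ball.\<close>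
  have Fs: "norm (f (?s t)) \<le> L * norm (?s t)" if "t \<ge> 0" for t
    using L[rule_format, of "?s t" 0] sK[OF that] K f0 by simp
  have F: "norm (f (?s t)) \<le> (L * K) * exp (- a * t)" if "t \<ge> 0" for t
    using order_trans[OF Fs[OF that] mult_left_mono[OF s[OF that] \<open>L \<ge> 0\<close>]] by simp
  have prod: "p * q \<le> (P * Q) * exp (- (2 * a) * t)"
    if "0 \<le> p" "0 \<le> q" "p \<le> P * exp (- a * t)" "q \<le> Q * exp (- a * t)" for p q P Q t
  proof -
    have "p * q \<le> (P * exp (- a * t)) * (Q * exp (- a * t))"
      using that by (intro mult_mono) auto
    also have "\<dots> = (P * Q) * (exp (- a * t) * exp (- a * t))"
      by (simp only: mult_ac)
    also have "exp (- a * t) * exp (- a * t) = exp (- (2 * a) * t)"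
      by (simp flip: exp_add)
    finally show ?thesis .
  qed
  have cs: "continuous_on {0..} ?s"
    using ode_solution_continuous_on[OF ode_solution_flow] x0 unfolding region_of_attraction_def by auto
  have "continuous_on UNIV f"
    using f by (simp add: continuous_at_imp_continuous_on differentiable_imp_continuous_within)
  then have cF: "continuous_on {0..} (\<lambda>t. f (?s t))"
    using continuous_on_compose2[OF _ cs] by blast
  show "(\<lambda>t. (norm (f (?s t)))\<^sup>2) integrable_on {0..}"
    using prod[OF _ _ F F] a
    by (intro integrable_on_exponential_bound[where a = "2 * a" and K = "(L * K) * (L * K)"] continuous_intros cF)
      (auto simp: power2_eq_square)
  show "(\<lambda>t. outer (f (?s t)) (?s t)) integrable_on {0..}"
    using prod[OF _ _ F s] a
    by (intro integrable_on_exponential_bound[where a = "2 * a" and K = "(L * K) * K"] continuous_on_outer cF cs)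
      (auto simp: norm_outer)
  show "(\<lambda>t. outer (?s t) (?s t)) integrable_on {0..}"
    using prod[OF _ _ s s] a
    by (intro integrable_on_exponential_bound[where a = "2 * a" and K = "K * K"] continuous_on_outer cs)
      (auto simp: norm_outer)
qed

theorem theorem1:
  fixes f :: "real^'n \<Rightarrow> real^'n" and A :: "real^'n^'n" and x0 :: "real^'n"
  assumes "smooth f" and "f 0 = 0"
    and "locally_exponentially_stable f"
    and "A = jacobian f (at 0)" and "hurwitz A"
    and "((\<lambda>x. norm (f x - A *v x) / norm x) \<longlongrightarrow> 0) (at 0)"
    and "x0 \<in> region_of_attraction f"
  shows "(strictly_convex_on UNIV (\<lambda>B. J f B x0) \<longleftrightarrow> pos_def (Gamma2 f x0)) \<and>
    (pos_def (Gamma2 f x0) \<longrightarrow>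
      (\<forall>B. is_arg_min (\<lambda>B. J f B x0) (\<lambda>_. True) B \<longleftrightarrow>
           B = Gamma1 f x0 ** matrix_inv (Gamma2 f x0)))"
proof -
  have "Ck (Suc 0) f"
    using assms(1) unfolding smooth_def by blast
  note int = flow_products_integrable[OF this assms(2,3,7)]
  have "(\<lambda>B. J f B x0) = matrix_quadratic (integral {0..} (\<lambda>t. (norm (f (flow f t x0)))\<^sup>2))
      (Gamma1 f x0) (Gamma2 f x0)"
    using J_eq_matrix_quadratic[OF int] by blast
  then show ?thesis
    using strictly_convex_matrix_quadratic_iff[OF transpose_Gamma2[OF int(3)]]
      is_arg_min_matrix_quadratic_iff by metis
qed

end
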